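(* Let $(X,d)$ be a Bourbaki-complete metric space. Then there exist cardinals $\kappa_n$ ($n\in\mathbb N$) and a (topological) embedding $$\varphi:(X,d)\rightarrow\Big(\big(\prod_{n\in\mathbb N}\kappa_n\big)\times\mathbb R^{\omega_0},\ \rho+t\Big),$$ where each $\kappa_n$ is endowed with the uniformly discrete metric $\chi$, such that $\varphi$ is uniformly continuous and $\varphi(X)$ is a closed subspace of $\big(\prod_{n\in\mathbb N}\kappa_n\big)\times\mathbb R^{\omega_0}$. Moreover, $$\wp(X,d)\leq\sup\Big\{\prod_{j=1}^n\kappa_j:n\in\mathbb N\Big\}.$$
   Context: For a cover $\mathcal U$ of $X$ and $A\subset X$: $St(A,\mathcal U)=\bigcup\{U\in\mathcal U: U\cap A\neq\emptyset\}$, $St^0(A,\mathcal U)=A$, $St^m(A,\mathcal U)=St(St^{m-1}(A,\mathcal U),\mathcal U)$ for $m\geq 1$. For a metric space $(X,d)$, the metric uniformity $\mu_d$ is the family of covers refined by $\{B_d(x,\varepsilon):x\in X\}$ for some $\varepsilon>0$. A filter $\mathcal F$ on $X$ is Bourbaki-Cauchy if for every $\mathcal U\in\mu_d$ there are $m\in\mathbb N$, $U\in\mathcal U$ and $F\in\mathcal F$ with $F\subset St^m(U,\mathcal U)$. $(X,d)$ is Bourbaki-complete if every Bourbaki-Cauchy filter has a cluster point. The uniformly discrete metric on a set is $\chi(d,e)=0$ if $d=e$ and $\chi(d,e)=1$ otherwise. On a countable product of discrete spaces, $\rho$ is the first difference metric: $\rho((d_n)_n,(e_n)_n)=0$ if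 $d_n=e_n$ for all $n$, and $=1/n$ if $d_j=e_j$ for $j=1,\dots,n-1$ and $d_n\neq e_n$. On $\mathbb R^{\omega_0}$, $t((x_n)_n,(y_n)_n)=\sum_{n=1}^\infty \min\{|x_n-y_n|,1\}/2^n$. $\rho+t$ is the sum metric on the product. A topological embedding is a homeomorphism onto its image. A uniform partition of $(X,d)$ is a partition of $X$ belonging to $\mu_d$. $\wp(X,d)=\sup\{|\mathcal P|:\mathcal P\text{ is a uniform partition of }(X,d)\}$. *)

theory Defs
  imports "HOL-Analysis.Analysis"
begin

unbundle cardinal_syntax

section \<open>Suprema of sets of cardinals\<close>

text \<open>Cardinals are cardinal orders, identified up to \<open>=o\<close>.\<close>

definition is_card_Sup :: "'a rel set \<Rightarrow> 'a rel \<Rightarrow> bool" where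
  "is_card_Sup S r \<longleftrightarrow> Card_order r \<and> (\<forall>s\<in>S. s \<le>o r) \<and>
     (\<forall>r'::'a rel. Card_order r' \<and> (\<forall>s\<in>S. s \<le>o r') \<longrightarrow> r \<le>o r')"

definition card_Sup :: "'a rel set \<Rightarrow> 'a rel" where
  "card_Sup S = (SOME r. is_card_Sup S r)"

lemma is_card_Sup_card_Sup:
  fixes S :: "'a rel set"
  assumes "\<And>s. s \<in> S \<Longrightarrow> Card_order s"
  shows "is_card_Sup S (card_Sup S)"
proof -
  let ?R = "{r::'a rel. Card_order r \<and> (\<forall>s\<in>S. s \<le>o r)}"
  have "s \<le>o |UNIV :: 'a set|" if "s \<in> S" for s
  proof -
    have "s =o |Field s|"
      using assms[OF that] card_of_Field_ordIso ordIso_symmetric by blast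
    moreover have "|Field s| \<le>o |UNIV :: 'a set|"
      by (rule card_of_mono1) simp
    ultimately show ?thesis
      using ordIso_ordLeq_trans by blast
  qed
  then have "|UNIV :: 'a set| \<in> ?R"
    by (simp add: card_of_Card_order)
  then have "?R \<noteq> {}" by blast
  then have "\<exists>r\<in>?R. \<forall>r'\<in>?R. r \<le>o r'"
    by (rule exists_minim_Card_order) simp
  then have "\<exists>r. is_card_Sup S r"
    unfolding is_card_Sup_def by auto
  then show ?thesis
    unfolding card_Sup_def by (rule someI_ex)
qed

text \<open>The supremum is also least among upper bounds living on other types.\<close>

lemma card_Sup_least:
  fixes S :: "'a rel set" and r :: "'b rel"
  assumes S: "\<And>s. s \<in> S \<Longrightarrow> Card_order s" and r: "Card_order r" "\<And>s. s \<in> S \<Longrightarrow> s \<le>o r"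
  shows "card_Sup S \<le>o r"
proof (rule ccontr)
  have sup: "is_card_Sup S (card_Sup S)"
    using S by (rule is_card_Sup_card_Sup)
  then have c: "Card_order (card_Sup S)"
    by (simp add: is_card_Sup_def)
  assume "\<not> card_Sup S \<le>o r"
  then have less: "r <o card_Sup S"
    using c r(1) not_ordLess_iff_ordLeq unfolding card_order_on_def by blast
  then obtain p :: "'a rel" where p: "r =o p"
    using internalize_ordLeq[of r "card_Sup S"] ordLess_imp_ordLeq by blast
  have "Card_order p"
    using p r(1) Card_order_ordIso2 by blast
  moreover have "s \<le>o p" if "s \<in> S" for s
    using r(2)[OF that] p ordLeq_ordIso_trans by blast
  ultimately have "card_Sup S \<le>o p"
    using sup by (simp add: is_card_Sup_def)
  then have "card_Sup S \<le>o r"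
    using p ordIso_symmetric ordLeq_ordIso_trans by blast
  then show False
    using less not_ordLess_ordLeq by blast
qed

section \<open>The metric uniformity and Bourbaki-completeness\<close>

definition star :: "'a set \<Rightarrow> 'a set set \<Rightarrow> 'a set" where
  "star A \<U> = \<Union>{U \<in> \<U>. U \<inter> A \<noteq> {}}"

primrec star_iter :: "nat \<Rightarrow> 'a set \<Rightarrow> 'a set set \<Rightarrow> 'a set" where
  "star_iter 0 A \<U> = A"
| "star_iter (Suc k) A \<U> = star (star_iter k A \<U>) \<U>"

definition metric_uniformity :: "'a metric \<Rightarrow> 'a set set set" where
  "metric_uniformity m = {\<U>. \<Union>\<U> = mspace m \<and>
     (\<exists>\<epsilon>>0. \<forall>x\<in>mspace m. \<exists>U\<in>\<U>. mball_of m x \<epsilon> \<subseteq> U)}"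

text \<open>A filter on the space is a proper filter on the underlying type to which the
  carrier belongs.\<close>

definition filter_on :: "'a metric \<Rightarrow> 'a filter \<Rightarrow> bool" where
  "filter_on m \<F> \<longleftrightarrow> \<F> \<noteq> bot \<and> eventually (\<lambda>x. x \<in> mspace m) \<F>"

definition Bourbaki_Cauchy :: "'a metric \<Rightarrow> 'a filter \<Rightarrow> bool" where
  "Bourbaki_Cauchy m \<F> \<longleftrightarrow>
     (\<forall>\<U>\<in>metric_uniformity m. \<exists>k. \<exists>U\<in>\<U>. \<exists>F. eventually (\<lambda>x. x \<in> F) \<F> \<and> F \<subseteq> star_iter k U \<U>)"

definition cluster_point :: "'a metric \<Rightarrow> 'a filter \<Rightarrow> 'a \<Rightarrow> bool" where
  "cluster_point m \<F> x \<longleftrightarrow> x \<in> mspace m \<and>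
     (\<forall>V F. openin (mtopology_of m) V \<and> x \<in> V \<and> eventually (\<lambda>y. y \<in> F) \<F> \<longrightarrow> V \<inter> F \<noteq> {})"

definition Bourbaki_complete :: "'a metric \<Rightarrow> bool" where
  "Bourbaki_complete m \<longleftrightarrow>
     (\<forall>\<F>. filter_on m \<F> \<and> Bourbaki_Cauchy m \<F> \<longrightarrow> (\<exists>x. cluster_point m \<F> x))"

definition uniform_partition :: "'a metric \<Rightarrow> 'a set set \<Rightarrow> bool" where
  "uniform_partition m P \<longleftrightarrow> partition_on (mspace m) P \<and> P \<in> metric_uniformity m"

definition uniform_partition_sup :: "'a metric \<Rightarrow> 'a set rel" where
  "uniform_partition_sup m = card_Sup {|P| | P. uniform_partition m P}"

section \<open>The target space\<close>

definition uniformly_discrete_metric :: "'a set \<Rightarrow> 'a metric" where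
  "uniformly_discrete_metric K = metric (K, discrete_metric.dd)"

lemma mspace_uniformly_discrete_metric [simp]: "mspace (uniformly_discrete_metric K) = K"
  by (simp add: uniformly_discrete_metric_def Metric_space.mspace_metric metric_M_dd)

lemma mdist_uniformly_discrete_metric [simp]:
  "mdist (uniformly_discrete_metric K) x y = (if x = y then 0 else 1)"
  unfolding uniformly_discrete_metric_def Metric_space.mdist_metric[OF metric_M_dd]
  by (simp add: discrete_metric.dd_def)

text \<open>Sequences are indexed from 0, so the index \<open>n\<close> here plays the role of \<open>n + 1\<close> in the
  usual definitions of the first difference metric and of the metric on the sequence space.\<close>

definition first_difference_dist :: "(nat \<Rightarrow> 'a) \<Rightarrow> (nat \<Rightarrow> 'a) \<Rightarrow> real" where
  "first_difference_dist x y = (if x = y then 0 else 1 / real (Suc (LEAST n. x n \<noteq> y n)))"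

text \<open>Meant for discrete factors: only the carriers of the factors enter.\<close>

definition first_difference_metric :: "(nat \<Rightarrow> 'a metric) \<Rightarrow> (nat \<Rightarrow> 'a) metric" where
  "first_difference_metric D = metric (\<Pi>\<^sub>E n\<in>UNIV. mspace (D n), first_difference_dist)"

lemma first_difference_dist_le_iff:
  assumes "x \<noteq> y"
  shows "first_difference_dist x y \<le> 1 / real (Suc n) \<longleftrightarrow> (\<forall>j<n. x j = y j)"
proof -
  define k where "k = (LEAST n. x n \<noteq> y n)"
  obtain i where "x i \<noteq> y i"
    using assms by blast
  then have k: "x k \<noteq> y k"
    unfolding k_def by (rule LeastI)
  have less_k: "x j = y j" if "j < k" for j
    using not_less_Least[OF that[unfolded k_def]] by simp
  have "first_difference_dist x y \<le> 1 / real (Suc n) \<longleftrightarrow> n \<le> k"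
    using assms by (simp add: first_difference_dist_def k_def[symmetric] field_simps)
  also have "\<dots> \<longleftrightarrow> (\<forall>j<n. x j = y j)"
  proof
    show "\<forall>j<n. x j = y j" if "n \<le> k"
      using that less_k by simp
    show "n \<le> k" if "\<forall>j<n. x j = y j"
      using that k not_le_imp_less by blast
  qed
  finally show ?thesis .
qed

lemma Metric_space_first_difference: "Metric_space M first_difference_dist"
proof
  fix x y z :: "nat \<Rightarrow> 'a"
  show "0 \<le> first_difference_dist x y"
    by (simp add: first_difference_dist_def)
  show "first_difference_dist x y = first_difference_dist y x"
    by (simp add: first_difference_dist_def eq_commute)
  show "(first_difference_dist x y = 0) = (x = y)"
    by (simp add: first_difference_dist_def)
  show "first_difference_dist x z \<le> first_difference_dist x y + first_difference_dist y z"
  proof (cases "x = y \<or> y = z \<or> x = z")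
    case True
    then show ?thesis by (auto simp: first_difference_dist_def)
  next
    case False
    define a b where "a = (LEAST n. x n \<noteq> y n)" and "b = (LEAST n. y n \<noteq> z n)"
    have xy: "first_difference_dist x y = 1 / real (Suc a)"
      and yz: "first_difference_dist y z = 1 / real (Suc b)"
      using False by (simp_all add: first_difference_dist_def a_def b_def)
    have "x j = z j" if "j < min a b" for j
    proof -
      have j: "j < (LEAST n. x n \<noteq> y n)" "j < (LEAST n. y n \<noteq> z n)"
        using that by (simp_all add: a_def b_def)
      show ?thesis
        using not_less_Least[OF j(1)] not_less_Least[OF j(2)] by simp
    qed
    moreover have "x \<noteq> z" using False by blast
    ultimately have "first_difference_dist x z \<le> 1 / real (Suc (min a b))"
      by (meson first_difference_dist_le_iff)
    also have "\<dots> \<le> 1 / real (Suc a) + 1 / real (Suc b)"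
      by (simp add: min_def)
    finally show ?thesis unfolding xy yz .
  qed
qed

lemma mspace_first_difference_metric [simp]:
  "mspace (first_difference_metric D) = (\<Pi>\<^sub>E n\<in>UNIV. mspace (D n))"
  by (simp add: first_difference_metric_def Metric_space.mspace_metric Metric_space_first_difference)

lemma mdist_first_difference_metric [simp]:
  "mdist (first_difference_metric D) = first_difference_dist"
  by (simp add: first_difference_metric_def Metric_space.mdist_metric Metric_space_first_difference)

definition real_sequence_dist :: "(nat \<Rightarrow> real) \<Rightarrow> (nat \<Rightarrow> real) \<Rightarrow> real" where
  "real_sequence_dist x y = (\<Sum>n. min \<bar>x n - y n\<bar> 1 / 2 ^ Suc n)"

definition real_sequence_metric :: "(nat \<Rightarrow> real) metric" where
  "real_sequence_metric = metric (UNIV, real_sequence_dist)"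

lemma summable_real_sequence_dist: "summable (\<lambda>n. min \<bar>x n - y n\<bar> 1 / 2 ^ Suc n :: real)"
proof (rule summable_comparison_test')
  show "summable (\<lambda>n. (1/2) ^ Suc n :: real)"
    by (intro summable_Suc_iff[THEN iffD2] summable_geometric) simp
  show "norm (min \<bar>x n - y n\<bar> 1 / 2 ^ Suc n) \<le> (1/2) ^ Suc n" for n
    by (simp add: power_divide divide_right_mono)
qed

lemma Metric_space_real_sequence: "Metric_space UNIV real_sequence_dist"
proof
  fix x y z :: "nat \<Rightarrow> real"
  show "0 \<le> real_sequence_dist x y"
    unfolding real_sequence_dist_def by (intro suminf_nonneg summable_real_sequence_dist) simp
  show "real_sequence_dist x y = real_sequence_dist y x"
    by (simp add: real_sequence_dist_def abs_minus_commute)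
  have "real_sequence_dist x y = 0 \<longleftrightarrow> (\<forall>n. min \<bar>x n - y n\<bar> 1 / 2 ^ Suc n = 0)"
    unfolding real_sequence_dist_def
    by (intro suminf_eq_zero_iff summable_real_sequence_dist) simp
  also have "\<dots> \<longleftrightarrow> x = y"
    by (auto simp: fun_eq_iff min_def)
  finally show "(real_sequence_dist x y = 0) = (x = y)" .
  have "real_sequence_dist x z \<le>
      (\<Sum>n. min \<bar>x n - y n\<bar> 1 / 2 ^ Suc n + min \<bar>y n - z n\<bar> 1 / 2 ^ Suc n)"
    unfolding real_sequence_dist_def
  proof (intro suminf_le summable_add summable_real_sequence_dist)
    show "min \<bar>x n - z n\<bar> 1 / 2 ^ Suc n
        \<le> min \<bar>x n - y n\<bar> 1 / 2 ^ Suc n + min \<bar>y n - z n\<bar> 1 / 2 ^ Suc n" for n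
      unfolding add_divide_distrib[symmetric] by (rule divide_right_mono) auto
  qed
  also have "\<dots> = real_sequence_dist x y + real_sequence_dist y z"
    unfolding real_sequence_dist_def
    by (intro suminf_add[symmetric] summable_real_sequence_dist)
  finally show "real_sequence_dist x z \<le> real_sequence_dist x y + real_sequence_dist y z" .
qed

lemma mspace_real_sequence_metric [simp]: "mspace real_sequence_metric = UNIV"
  by (simp add: real_sequence_metric_def Metric_space.mspace_metric Metric_space_real_sequence)

lemma mdist_real_sequence_metric [simp]: "mdist real_sequence_metric = real_sequence_dist"
  by (simp add: real_sequence_metric_def Metric_space.mdist_metric Metric_space_real_sequence)

definition sum_metric :: "'a metric \<Rightarrow> 'b metric \<Rightarrow> ('a \<times> 'b) metric" where
  "sum_metric m1 m2 =
     metric (mspace m1 \<times> mspace m2, \<lambda>(x, y) (x', y'). mdist m1 x x' + mdist m2 y y')"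

lemma Metric_space_sum_metric:
  "Metric_space (mspace m1 \<times> mspace m2) (\<lambda>(x, y) (x', y'). mdist m1 x x' + mdist m2 y y')"
proof
  fix p q r :: "'a \<times> 'b"
  let ?d = "\<lambda>(x, y) (x', y'). mdist m1 x x' + mdist m2 y y'"
  show "0 \<le> ?d p q" by (auto split: prod.splits)
  show "?d p q = ?d q p" by (auto split: prod.splits simp: mdist_commute)
  assume p: "p \<in> mspace m1 \<times> mspace m2" and q: "q \<in> mspace m1 \<times> mspace m2"
  then show "(?d p q = 0) = (p = q)"
    by (auto split: prod.splits simp: add_nonneg_eq_0_iff)
  assume r: "r \<in> mspace m1 \<times> mspace m2"
  show "?d p r \<le> ?d p q + ?d q r"
    using p q r mdist_triangle[of "fst p" m1 "fst q" "fst r"]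
      mdist_triangle[of "snd p" m2 "snd q" "snd r"]
    by (auto split: prod.splits)
qed

lemma mspace_sum_metric [simp]: "mspace (sum_metric m1 m2) = mspace m1 \<times> mspace m2"
  using Metric_space.mspace_metric[OF Metric_space_sum_metric] by (simp add: sum_metric_def)

lemma mdist_sum_metric [simp]:
  "mdist (sum_metric m1 m2) (x, y) (x', y') = mdist m1 x x' + mdist m2 y y'"
  unfolding sum_metric_def Metric_space.mdist_metric[OF Metric_space_sum_metric] by simp

definition target_metric :: "(nat \<Rightarrow> 'a rel) \<Rightarrow> ((nat \<Rightarrow> 'a) \<times> (nat \<Rightarrow> real)) metric" where
  "target_metric \<kappa> =
     sum_metric (first_difference_metric (\<lambda>n. uniformly_discrete_metric (Field (\<kappa> n))))
       real_sequence_metric"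

end

theory Submission
  imports Defs
begin

text \<open>
  Write \<open>M\<close> for the carrier. For each \<open>n\<close>, the classes of points joined by chains with steps
  shorter than \<open>1 / (n + 1)\<close> form a uniform partition of \<open>M\<close>, and every uniform partition is
  refined by one of these. Choosing a base point in each class gives the cardinal \<open>\<kappa> n\<close>, the
  number of classes, and the map sending a point to its sequence of base points is uniformly
  continuous for the first difference metric. It also yields the bound on the sizes of uniform
  partitions: already the last factor of the product of \<open>\<kappa> 0, \<dots>, \<kappa> n\<close> separates the members of a
  partition refined by the \<open>n\<close>-th one.

  The real coordinates are of two kinds, all of them uniformly continuous.

  The first kind makes the map closed. The chain cost of \<open>x\<close> at scale \<open>n\<close> measures how long a
  chain from the base point of its class to \<open>x\<close> has to be; it is Lipschitz for points closer than
  \<open>1 / (n + 1)\<close>, and a bound on it bounds the number of steps. Hence a filter on which, at every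
  scale, the base point is eventually constant and the chain cost eventually bounded is
  Bourbaki-Cauchy and has a cluster point (\<open>cluster_point_if_chain_costs_bounded\<close>). A filter in \<open>M\<close>
  whose image converges in the target is of this form.

  The second kind makes the map injective. The same lemma shows that for every \<open>x\<close> and \<open>k\<close>,
  finitely many conditions on base points and on integer bounds of chain costs cut out a set
  containing \<open>x\<close> that is covered by finitely many balls of radius \<open>1 / (k + 1)\<close>
  (\<open>block_has_net\<close>). The distances to the centres of these balls separate \<open>x\<close> from the other
  points. There may be uncountably many such sets, but those with the same integer bounds and
  different base points lie in different classes of one uniform partition, so they can share
  their real coordinates. Only countably many lists of bounds remain.

  An injective, continuous and closed map is an embedding with closed image.
\<close>

section \<open>Chains of small steps\<close>

lemma mdist_self [simp]: "x \<in> mspace m \<Longrightarrow> mdist m x x = 0"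
  by simp

lemma openin_mball_of: "openin (mtopology_of m) (mball_of m x r)"
  by (simp add: mtopology_of_def mball_of_def Metric_space.openin_mball)

text \<open>The pairs of points at distance less than \<open>1 / (n + 1)\<close>; chains of \<open>k\<close> steps
  correspond to the \<open>k\<close>-th power of this relation.\<close>

definition step :: "'a metric \<Rightarrow> nat \<Rightarrow> 'a rel" where
  "step m n = {(x, y). x \<in> mspace m \<and> y \<in> mspace m \<and> mdist m x y < 1 / real (Suc n)}"

text \<open>A point chosen in the class of \<open>x\<close> under joinability by chains at scale \<open>n\<close>. It depends only
  on the class, so it also serves as a label for it. Outside the carrier the relation is the
  identity, and so is \<open>base_pt\<close>.\<close>

definition base_pt :: "'a metric \<Rightarrow> nat \<Rightarrow> 'a \<Rightarrow> 'a" where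
  "base_pt m n x = (SOME y. (x, y) \<in> (step m n)\<^sup>*)"

lemma step_refl: "x \<in> mspace m \<Longrightarrow> (x, x) \<in> step m n"
  by (simp add: step_def)

lemma sym_step: "sym (step m n)"
  by (auto simp: step_def mdist_commute intro!: symI)

lemma step_antimono: "j \<le> n \<Longrightarrow> step m n \<subseteq> step m j"
  by (auto simp: step_def elim!: order_less_le_trans intro!: divide_left_mono)

lemma base_pt_reachable: "(x, base_pt m n x) \<in> (step m n)\<^sup>*"
  unfolding base_pt_def by (rule someI[of _ x]) simp

lemma reachable_base_pt: "(base_pt m n x, x) \<in> (step m n)\<^sup>*"
  using base_pt_reachable[of x m n] sym_rtrancl[OF sym_step] by (rule symD[rotated])

lemma base_pt_eq_iff: "base_pt m n x = base_pt m n y \<longleftrightarrow> (x, y) \<in> (step m n)\<^sup>*"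
proof
  show "(x, y) \<in> (step m n)\<^sup>*" if "base_pt m n x = base_pt m n y"
    using base_pt_reachable[of x m n] reachable_base_pt[of m n y] that by simp
  assume xy: "(x, y) \<in> (step m n)\<^sup>*"
  then have yx: "(y, x) \<in> (step m n)\<^sup>*"
    using sym_rtrancl[OF sym_step] by (rule symD[rotated])
  have "((x, z) \<in> (step m n)\<^sup>*) = ((y, z) \<in> (step m n)\<^sup>*)" for z
    using xy yx by (blast intro: rtrancl_trans)
  then show "base_pt m n x = base_pt m n y"
    by (simp add: base_pt_def)
qed

lemma base_pt_eq_of_close:
  assumes "x \<in> mspace m" "y \<in> mspace m" "mdist m x y < 1 / real (Suc n)" "j \<le> n"
  shows "base_pt m j x = base_pt m j y"
proof -
  have "(x, y) \<in> step m j"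
    using assms step_antimono[OF \<open>j \<le> n\<close>, of m] by (auto simp: step_def)
  then show ?thesis by (auto simp: base_pt_eq_iff)
qed

text \<open>The last step of a chain from the base point to \<open>x\<close> is charged its length, and every other
  step the full \<open>1 / (n + 1)\<close>. Charging a fixed price per step lets the cost control the
  number of steps; charging the last one its length makes the infimum uniformly continuous.
  The requirement that the last link be a step cannot be dropped: otherwise the chain of length
  0 would bound the cost by the distance to the base point. The set is empty, and the infimum
  without meaning, for \<open>x\<close> outside the carrier.\<close>

definition chain_costs :: "'a metric \<Rightarrow> nat \<Rightarrow> 'a \<Rightarrow> real set" where
  "chain_costs m n x = {real k / real (Suc n) + mdist m y x | k y.
     (base_pt m n x, y) \<in> step m n ^^ k \<and> (y, x) \<in> step m n}"

definition chain_cost :: "'a metric \<Rightarrow> nat \<Rightarrow> 'a \<Rightarrow> real" where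
  "chain_cost m n x = Inf (chain_costs m n x)"

lemma chain_costs_nonempty: "x \<in> mspace m \<Longrightarrow> chain_costs m n x \<noteq> {}"
  using reachable_base_pt[of m n x] step_refl[of x m n]
  unfolding chain_costs_def rtrancl_power by blast

lemma chain_cost_le: "r \<in> chain_costs m n x \<Longrightarrow> chain_cost m n x \<le> r"
  unfolding chain_cost_def
  by (rule cInf_lower) (auto simp: chain_costs_def bdd_below_def intro!: exI[of _ 0])

lemma chain_cost_less_ex:
  assumes "x \<in> mspace m" "chain_cost m n x < r"
  shows "\<exists>k y. (base_pt m n x, y) \<in> step m n ^^ k \<and> (y, x) \<in> step m n \<and>
    real k / real (Suc n) + mdist m y x < r"
proof -
  obtain s where "s \<in> chain_costs m n x" "s < r"
    using cInf_lessD[OF chain_costs_nonempty[OF assms(1)]] assms(2)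
    unfolding chain_cost_def by blast
  then show ?thesis
    unfolding chain_costs_def by blast
qed

lemma chain_cost_le_close:
  assumes x: "x \<in> mspace m" and y: "y \<in> mspace m" and d: "mdist m x y < 1 / real (Suc n)"
  shows "chain_cost m n y \<le> chain_cost m n x + 2 * mdist m x y"
proof (rule field_le_epsilon)
  fix e :: real assume "e > 0"
  then obtain k z where k: "(base_pt m n x, z) \<in> step m n ^^ k" and z: "(z, x) \<in> step m n"
    and less: "real k / real (Suc n) + mdist m z x < chain_cost m n x + e"
    using chain_cost_less_ex[OF x, of n "chain_cost m n x + e"] by (meson less_add_same_cancel1)
  have zM: "z \<in> mspace m" using z by (simp add: step_def)
  have eq: "base_pt m n y = base_pt m n x"
    using base_pt_eq_of_close[OF x y d, of n] by simp
  have tri: "mdist m z y \<le> mdist m z x + mdist m x y"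
    by (rule mdist_triangle[OF zM x y])
  show "chain_cost m n y \<le> chain_cost m n x + 2 * mdist m x y + e"
  proof (cases "mdist m z y < 1 / real (Suc n)")
    case True
    then have "real k / real (Suc n) + mdist m z y \<in> chain_costs m n y"
      using k zM y unfolding chain_costs_def eq by (auto simp: step_def)
    then have "chain_cost m n y \<le> real k / real (Suc n) + mdist m z y"
      by (rule chain_cost_le)
    then show ?thesis
      using tri less mdist_nonneg[of m x y] by linarith
  next
    \<comment> \<open>The chain is extended by \<open>x\<close>. The full price of the step from \<open>z\<close> to \<open>x\<close> is at most the
      distance from \<open>z\<close> to \<open>y\<close>, and the step from \<open>x\<close> to \<open>y\<close> is charged its length, so the
      distance from \<open>x\<close> to \<open>y\<close> counts twice.\<close>
    case False
    have "(base_pt m n x, x) \<in> step m n ^^ Suc k"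
      using k z by auto
    moreover have "(x, y) \<in> step m n"
      using x y d by (simp add: step_def)
    ultimately have "real (Suc k) / real (Suc n) + mdist m x y \<in> chain_costs m n y"
      unfolding chain_costs_def eq by blast
    then have "chain_cost m n y \<le> real (Suc k) / real (Suc n) + mdist m x y"
      by (rule chain_cost_le)
    also have "\<dots> = real k / real (Suc n) + 1 / real (Suc n) + mdist m x y"
      by (simp add: add_divide_distrib)
    finally show ?thesis using False tri less by linarith
  qed
qed

lemma chain_cost_abs_close:
  assumes "x \<in> mspace m" "y \<in> mspace m" "mdist m x y < 1 / real (Suc n)"
  shows "\<bar>chain_cost m n x - chain_cost m n y\<bar> \<le> 2 * mdist m x y"
  using chain_cost_le_close[OF assms] chain_cost_le_close[of y m x n] assms
  by (simp add: mdist_commute abs_le_iff)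

lemma chain_cost_bound_steps:
  assumes x: "x \<in> mspace m" and le: "chain_cost m n x \<le> R"
  shows "\<exists>k \<le> Suc (nat \<lceil>(R + 1) * real (Suc n)\<rceil>). (base_pt m n x, x) \<in> step m n ^^ k"
proof -
  \<comment> \<open>The infimum need not be attained, whence \<open>R + 1\<close>.\<close>
  obtain k y where k: "(base_pt m n x, y) \<in> step m n ^^ k" "(y, x) \<in> step m n"
    and less: "real k / real (Suc n) + mdist m y x < R + 1"
    using chain_cost_less_ex[OF x, of n "R + 1"] le by (meson le_less_trans less_add_one)
  have "real k / real (Suc n) < R + 1"
    using less mdist_nonneg[of m y x] by linarith
  then have "real k < (R + 1) * real (Suc n)"
    by (simp add: divide_less_eq)
  then have "k \<le> nat \<lceil>(R + 1) * real (Suc n)\<rceil>"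
    by linarith
  moreover have "(base_pt m n x, x) \<in> step m n ^^ Suc k"
    using k by auto
  ultimately show ?thesis by (meson Suc_le_mono)
qed

section \<open>Bourbaki-Cauchy filters\<close>

lemma star_iter_mono_index:
  assumes "A \<subseteq> \<Union>\<U>" "k \<le> l"
  shows "star_iter k A \<U> \<subseteq> star_iter l A \<U>"
proof -
  have sub: "star_iter i A \<U> \<subseteq> \<Union>\<U>" for i
    using assms(1) by (cases i) (auto simp: star_def)
  have "star_iter i A \<U> \<subseteq> star_iter (Suc i) A \<U>" for i
    using sub[of i] by (auto simp: star_def)
  then show ?thesis
    using \<open>k \<le> l\<close> by (rule lift_Suc_mono_le)
qed

lemma relpow_step_in_star_iter:
  assumes fine: "\<And>x y. (x, y) \<in> step m n \<Longrightarrow> \<exists>U\<in>\<U>. x \<in> U \<and> y \<in> U"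
    and "b \<in> A" "(b, x) \<in> step m n ^^ k"
  shows "x \<in> star_iter k A \<U>"
  using assms(3)
proof (induction k arbitrary: x)
  case 0
  then show ?case using \<open>b \<in> A\<close> by simp
next
  case (Suc k)
  then obtain y where "(b, y) \<in> step m n ^^ k" "(y, x) \<in> step m n"
    by auto
  with Suc.IH fine[of y x] show ?case
    by (fastforce simp: star_def)
qed

lemma metric_uniformity_fine:
  assumes "\<U> \<in> metric_uniformity m"
  shows "\<exists>n. \<forall>x y. (x, y) \<in> step m n \<longrightarrow> (\<exists>U\<in>\<U>. x \<in> U \<and> y \<in> U)"
proof -
  obtain e where e: "e > 0" "\<And>x. x \<in> mspace m \<Longrightarrow> \<exists>U\<in>\<U>. mball_of m x e \<subseteq> U"
    using assms by (auto simp: metric_uniformity_def)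
  obtain n where n: "1 / real (Suc n) < e"
    using nat_approx_posE[OF \<open>e > 0\<close>] by blast
  have "\<exists>U\<in>\<U>. x \<in> U \<and> y \<in> U" if "(x, y) \<in> step m n" for x y
  proof -
    have "x \<in> mball_of m x e" "y \<in> mball_of m x e"
      using that n \<open>e > 0\<close> by (auto simp: step_def)
    moreover obtain U where "U \<in> \<U>" "mball_of m x e \<subseteq> U"
      using e(2)[of x] calculation(1) unfolding in_mball_of by blast
    ultimately show ?thesis by blast
  qed
  then show ?thesis by blast
qed

lemma Bourbaki_Cauchy_if_chain_costs_bounded:
  assumes F: "filter_on m \<F>"
    and bd: "\<And>n. \<exists>b R. eventually (\<lambda>x. base_pt m n x = b \<and> chain_cost m n x \<le> R) \<F>"
  shows "Bourbaki_Cauchy m \<F>"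
  unfolding Bourbaki_Cauchy_def
proof
  fix \<U> assume \<U>: "\<U> \<in> metric_uniformity m"
  obtain n where fine: "\<And>x y. (x, y) \<in> step m n \<Longrightarrow> \<exists>U\<in>\<U>. x \<in> U \<and> y \<in> U"
    using metric_uniformity_fine[OF \<U>] by metis
  obtain b R where ev: "eventually (\<lambda>x. base_pt m n x = b \<and> chain_cost m n x \<le> R) \<F>"
    using bd by blast
  define S where "S = {x \<in> mspace m. base_pt m n x = b \<and> chain_cost m n x \<le> R}"
  have evS: "eventually (\<lambda>x. x \<in> S) \<F>"
    using ev F unfolding filter_on_def S_def by (auto elim: eventually_elim2)
  then obtain x where x: "x \<in> S"
    using F eventually_happens' unfolding filter_on_def by blast
  have "b \<in> mspace m"
  proof -
    have "(x, b) \<in> (step m n)\<^sup>*"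
      using base_pt_reachable[of x m n] x by (simp add: S_def)
    then show ?thesis
      using x by (cases rule: rtranclE) (auto simp: S_def step_def)
  qed
  then obtain U where U: "U \<in> \<U>" "b \<in> U"
    using fine[OF step_refl] by blast
  define K where "K = Suc (nat \<lceil>(R + 1) * real (Suc n)\<rceil>)"
  have "S \<subseteq> star_iter K U \<U>"
  proof
    fix y assume "y \<in> S"
    then obtain k where "k \<le> K" "(b, y) \<in> step m n ^^ k"
      using chain_cost_bound_steps[of y m n R] by (auto simp: S_def K_def)
    then show "y \<in> star_iter K U \<U>"
      using relpow_step_in_star_iter[OF fine U(2)] star_iter_mono_index[of U \<U> k K] U(1)
      by blast
  qed
  then show "\<exists>k. \<exists>U\<in>\<U>. \<exists>F. eventually (\<lambda>x. x \<in> F) \<F> \<and> F \<subseteq> star_iter k U \<U>"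
    using U(1) evS by blast
qed

lemma cluster_point_if_chain_costs_bounded:
  assumes "Bourbaki_complete m" "filter_on m \<F>"
    and "\<And>n. \<exists>b R. eventually (\<lambda>x. base_pt m n x = b \<and> chain_cost m n x \<le> R) \<F>"
  obtains p where "cluster_point m \<F> p"
  using assms Bourbaki_Cauchy_if_chain_costs_bounded unfolding Bourbaki_complete_def by blast

section \<open>Finite nets in blocks of bounded chain cost\<close>

text \<open>The points that, at the scales \<open>j < length L\<close>, lie in the class of \<open>x\<close> and have chain cost at
  most \<open>L ! j\<close>. The point \<open>x\<close> enters only through its classes and need not belong to its block.\<close>

definition block :: "'a metric \<Rightarrow> nat list \<Rightarrow> 'a \<Rightarrow> 'a set" where
  "block m L x = {y \<in> mspace m. \<forall>j<length L. base_pt m j y = base_pt m j x \<and> chain_cost m j y \<le> real (L ! j)}"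

text \<open>A finite list of centres of balls of radius \<open>1 / (k + 1)\<close> covering \<open>B\<close>.\<close>

definition is_net :: "'a metric \<Rightarrow> nat \<Rightarrow> 'a set \<Rightarrow> 'a list \<Rightarrow> bool" where
  "is_net m k B xs \<longleftrightarrow> set xs \<subseteq> mspace m \<and> B \<subseteq> (\<Union>c\<in>set xs. mball_of m c (1 / real (Suc k)))"

text \<open>A chosen net of \<open>B\<close>, or the empty list if there is none.\<close>

definition net :: "'a metric \<Rightarrow> nat \<Rightarrow> 'a set \<Rightarrow> 'a list" where
  "net m k B = (if \<exists>xs. is_net m k B xs then SOME xs. is_net m k B xs else [])"

text \<open>The distance of \<open>x\<close> to the \<open>i\<close>-th centre of the net chosen for its block, and 0 if there are
  not that many centres. Points closer than \<open>1 / (length L + 1)\<close> have the same block, hence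
  the same net, which makes this function uniformly continuous on the whole space although the
  centres vary from class to class.\<close>

definition net_dist :: "'a metric \<Rightarrow> nat \<Rightarrow> nat list \<Rightarrow> nat \<Rightarrow> 'a \<Rightarrow> real" where
  "net_dist m k L i x =
     (let xs = net m k (block m L x) in if i < length xs then mdist m (xs ! i) x else 0)"

lemma net_is_net: "is_net m k B xs \<Longrightarrow> is_net m k B (net m k B)"
  unfolding net_def by (auto intro: someI)

lemma net_in_mspace: "set (net m k B) \<subseteq> mspace m"
proof (cases "\<exists>xs. is_net m k B xs")
  case True
  then show ?thesis using net_is_net unfolding is_net_def by blast
next
  case False
  then show ?thesis by (simp add: net_def)
qed

lemma block_cong:
  assumes "\<And>j. j < length L \<Longrightarrow> base_pt m j x = base_pt m j y"
  shows "block m L x = block m L y"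
  using assms by (auto simp: block_def)

lemma net_dist_close:
  assumes x: "x \<in> mspace m" and y: "y \<in> mspace m"
    and d: "mdist m x y < 1 / real (Suc (length L))"
  shows "\<bar>net_dist m k L i x - net_dist m k L i y\<bar> \<le> mdist m x y"
proof -
  have eq: "block m L x = block m L y"
    by (rule block_cong) (use base_pt_eq_of_close[OF x y d] in auto)
  show ?thesis
  proof (cases "i < length (net m k (block m L y))")
    case True
    define c where "c = net m k (block m L y) ! i"
    have "c \<in> mspace m"
      using net_in_mspace[of m k "block m L y"] nth_mem[OF True] by (auto simp: c_def)
    then have "mdist m c x \<le> mdist m c y + mdist m y x" "mdist m c y \<le> mdist m c x + mdist m x y"
      using x y by (auto intro: mdist_triangle)
    then show ?thesis
      using True by (simp add: net_dist_def Let_def eq mdist_commute[of m y x] flip: c_def)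
  next
    case False
    then show ?thesis by (simp add: net_dist_def Let_def eq)
  qed
qed

text \<open>Take as bounds the chain costs of \<open>x\<close> itself, rounded up, at the scales below \<open>n\<close>. If none of
  the resulting decreasing blocks had a net, then the blocks together with the complements of
  finite unions of balls of radius \<open>1 / (k + 1)\<close> would generate a proper filter with bounded chain
  costs. Its cluster point would be the centre of one of the balls removed.\<close>

lemma block_has_net:
  assumes bc: "Bourbaki_complete m" and x: "x \<in> mspace m"
  obtains L xs where "x \<in> block m L x" "is_net m k (block m L x) xs"
proof (rule ccontr)
  define L where "L n = map (\<lambda>j. nat \<lceil>chain_cost m j x\<rceil>) [0..<n]" for n
  define B where "B n = block m (L n) x" for n
  have B: "B n = {y \<in> mspace m. \<forall>j<n. base_pt m j y = base_pt m j x \<and> chain_cost m j y \<le> real (nat \<lceil>chain_cost m j x\<rceil>)}"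
    for n
    by (auto simp: B_def block_def L_def)
  assume "\<not> thesis"
  then have no_net: "\<not> is_net m k (B n) xs" for n xs
    using that[of "L n" xs] x unfolding B_def block_def L_def
    by (auto simp: real_nat_ceiling_ge)
  \<comment> \<open>The second component of \<open>p\<close> is the set of centres of the balls removed.\<close>
  define S where "S p = B (fst p) - (\<Union>c\<in>snd p. mball_of m c (1 / real (Suc k)))"
    for p :: "nat \<times> 'a set"
  define J where "J = {p :: nat \<times> 'a set. finite (snd p) \<and> snd p \<subseteq> mspace m}"
  define \<F> where "\<F> = (INF p\<in>J. principal (S p))"
  have B_anti: "B l \<subseteq> B n" if "n \<le> l" for n l
    using that by (auto simp: B)
  have J0: "(n, {}) \<in> J" for n by (simp add: J_def)
  have ev_iff: "eventually P \<F> \<longleftrightarrow> (\<exists>p\<in>J. \<forall>x\<in>S p. P x)" for P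
    unfolding \<F>_def
  proof (subst eventually_INF_base)
    show "J \<noteq> {}" using J0 by blast
    fix p q assume "p \<in> J" "q \<in> J"
    then show "\<exists>r\<in>J. principal (S r) \<le> inf (principal (S p)) (principal (S q))"
      using B_anti[of "fst p" "max (fst p) (fst q)"] B_anti[of "fst q" "max (fst p) (fst q)"]
      by (intro bexI[of _ "(max (fst p) (fst q), snd p \<union> snd q)"]) (auto simp: J_def S_def)
  qed (simp add: eventually_principal)
  have "S p \<noteq> {}" if p: "p \<in> J" for p
  proof
    assume "S p = {}"
    moreover obtain xs where "set xs = snd p"
      using p finite_list[of "snd p"] unfolding J_def by blast
    ultimately have "is_net m k (B (fst p)) xs"
      using that by (auto simp: is_net_def S_def J_def)
    then show False using no_net by blast
  qed
  then have "\<F> \<noteq> bot"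
    unfolding trivial_limit_def ev_iff by blast
  moreover have evB: "eventually (\<lambda>y. y \<in> B n) \<F>" for n
    unfolding ev_iff using J0[of n] by (intro bexI[of _ "(n, {})"]) (auto simp: S_def)
  have "eventually (\<lambda>y. y \<in> mspace m) \<F>"
    using evB[of 0] by (simp add: B)
  ultimately have F: "filter_on m \<F>"
    by (simp add: filter_on_def)
  have "\<exists>b R. eventually (\<lambda>y. base_pt m n y = b \<and> chain_cost m n y \<le> R) \<F>" for n
    using evB[of "Suc n"]
    by (intro exI[of _ "base_pt m n x"] exI[of _ "real (nat \<lceil>chain_cost m n x\<rceil>)"])
      (auto simp: B elim: eventually_mono)
  then obtain p where p: "cluster_point m \<F> p"
    using cluster_point_if_chain_costs_bounded[OF bc F] by blast
  define V where "V = mball_of m p (1 / real (Suc k))"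
  have pM: "p \<in> mspace m" using p by (simp add: cluster_point_def)
  have "openin (mtopology_of m) V" "p \<in> V"
    using pM by (simp_all add: V_def openin_mball_of)
  moreover have "eventually (\<lambda>y. y \<in> S (0, {p})) \<F>"
    unfolding ev_iff using pM by (intro bexI[of _ "(0, {p})"]) (auto simp: J_def)
  ultimately have "V \<inter> S (0, {p}) \<noteq> {}"
    using p unfolding cluster_point_def by blast
  then show False by (auto simp: S_def V_def)
qed

lemma net_dist_separates:
  assumes bc: "Bourbaki_complete m" and x: "x \<in> mspace m" and y: "y \<in> mspace m" and "x \<noteq> y"
    and same_base: "\<And>j. base_pt m j x = base_pt m j y"
  obtains k L i where "net_dist m k L i x \<noteq> net_dist m k L i y"
proof (rule ccontr)
  assume "\<not> thesis"
  then have eq: "net_dist m k L i x = net_dist m k L i y" for k L i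
    using that by blast
  have pos: "mdist m x y / 2 > 0" using x y \<open>x \<noteq> y\<close> by (simp add: less_le)
  obtain k where k: "1 / real (Suc k) < mdist m x y / 2"
    using nat_approx_posE[OF pos] by blast
  obtain L xs where L: "x \<in> block m L x" and xs: "is_net m k (block m L x) xs"
    using block_has_net[OF bc x] by blast
  define ys where "ys = net m k (block m L x)"
  have ys: "is_net m k (block m L x) ys"
    unfolding ys_def using xs by (rule net_is_net)
  have ys': "net m k (block m L y) = ys"
    unfolding ys_def using block_cong[of L m x y] same_base by simp
  obtain c where c: "c \<in> set ys" "x \<in> mball_of m c (1 / real (Suc k))"
    using ys L by (auto simp: is_net_def)
  then obtain i where i: "i < length ys" "c = ys ! i"
    by (auto simp: in_set_conv_nth)
  have cM: "c \<in> mspace m" using c ys by (auto simp: is_net_def)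
  have "mdist m c x = mdist m c y"
    using eq[of k L i] i by (simp add: net_dist_def Let_def ys' flip: ys_def)
  then show False
    using c(2) k mdist_triangle[OF x cM y] by (simp add: mdist_commute[of m x c])
qed

section \<open>The metrics of the target\<close>

lemma real_sequence_dist_le:
  assumes "\<And>i. i < N \<Longrightarrow> \<bar>a i - b i\<bar> \<le> e" "e \<ge> 0"
  shows "real_sequence_dist a b \<le> e + (1/2) ^ N"
proof -
  have geo: "(\<lambda>i. (1/2) ^ Suc i :: real) sums 1"
    using power_half_series by simp
  define t where "t i = (if i < N then 0 else (1/2) ^ Suc i :: real)" for i
  have t: "t sums ((1/2) ^ N)"
  proof -
    have "(\<lambda>i. t (i + N)) sums ((1/2) ^ N)"
      using sums_mult[OF geo, of "(1/2) ^ N"] by (simp add: t_def power_add mult_ac)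
    then show ?thesis
      by (subst (asm) sums_iff_shift) (simp add: t_def)
  qed
  have s: "(\<lambda>i. e * (1/2) ^ Suc i + t i) sums (e + (1/2) ^ N)"
    using sums_add[OF sums_mult[OF geo, of e] t] by simp
  have "real_sequence_dist a b \<le> (\<Sum>i. e * (1/2) ^ Suc i + t i)"
    unfolding real_sequence_dist_def
  proof (intro suminf_le summable_real_sequence_dist)
    show "summable (\<lambda>i. e * (1/2) ^ Suc i + t i)"
      using s by (rule sums_summable)
    show "min \<bar>a i - b i\<bar> 1 / 2 ^ Suc i \<le> e * (1/2) ^ Suc i + t i" for i
    proof (cases "i < N")
      case True
      then have "min \<bar>a i - b i\<bar> 1 / 2 ^ Suc i \<le> e / 2 ^ Suc i"
        using assms(1)[OF True] by (intro divide_right_mono) auto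
      then show ?thesis using True by (simp add: t_def power_divide)
    next
      case False
      have "min \<bar>a i - b i\<bar> 1 / 2 ^ Suc i \<le> 1 / 2 ^ Suc i"
        by (intro divide_right_mono) auto
      also have "\<dots> \<le> e * (1/2) ^ Suc i + 1 / 2 ^ Suc i"
        using \<open>e \<ge> 0\<close> by simp
      finally show ?thesis using False by (simp add: t_def power_divide)
    qed
  qed
  then show ?thesis using sums_unique[OF s] by simp
qed

lemma abs_diff_less_if_real_sequence_dist:
  assumes "real_sequence_dist a b < e / 2 ^ Suc i" "e \<le> 1"
  shows "\<bar>a i - b i\<bar> < e"
proof -
  have "min \<bar>a i - b i\<bar> 1 / 2 ^ Suc i \<le> real_sequence_dist a b"
    using sum_le_suminf[OF summable_real_sequence_dist[of a b], of "{i}"]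
    by (simp add: real_sequence_dist_def)
  then have "min \<bar>a i - b i\<bar> 1 / 2 ^ Suc i < e / 2 ^ Suc i"
    using assms(1) by linarith
  then have "min \<bar>a i - b i\<bar> 1 < e"
    by (simp add: divide_less_cancel)
  then show ?thesis using assms(2) by auto
qed

section \<open>The embedding\<close>

text \<open>The real coordinates, indexed by a countable type: \<open>Inl n\<close> gives the chain cost at scale \<open>n\<close>,
  and \<open>Inr (k, L, i)\<close> the distance to the \<open>i\<close>-th centre of the net of radius \<open>1 / (k + 1)\<close>.\<close>

definition coord :: "'a metric \<Rightarrow> nat + nat \<times> nat list \<times> nat \<Rightarrow> 'a \<Rightarrow> real" where
  "coord m c x = (case c of Inl n \<Rightarrow> chain_cost m n x | Inr (k, L, i) \<Rightarrow> net_dist m k L i x)"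

text \<open>The real coordinates are listed by the surjection \<open>from_nat\<close> from the natural numbers onto
  their index type.\<close>

definition emb :: "'a metric \<Rightarrow> 'a \<Rightarrow> (nat \<Rightarrow> 'a) \<times> (nat \<Rightarrow> real)" where
  "emb m x = (\<lambda>n. base_pt m n x, \<lambda>i. coord m (from_nat i) x)"

text \<open>The number of classes at scale \<open>n\<close>, realised on the set of base points so that the underlying
  set of the cardinal is the range of the \<open>n\<close>-th coordinate.\<close>

definition base_card :: "'a metric \<Rightarrow> nat \<Rightarrow> 'a rel" where
  "base_card m n = |base_pt m n ` mspace m|"

lemma Field_base_card [simp]: "Field (base_card m n) = base_pt m n ` mspace m"
  by (simp add: base_card_def Field_card_of)

lemma mspace_target [simp]:
  "mspace (target_metric (base_card m)) = (\<Pi>\<^sub>E n\<in>UNIV. base_pt m n ` mspace m) \<times> UNIV"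
  by (simp add: target_metric_def)

lemma mdist_target [simp]:
  "mdist (target_metric \<kappa>) p q =
     first_difference_dist (fst p) (fst q) + real_sequence_dist (snd p) (snd q)"
  by (cases p; cases q) (simp add: target_metric_def)

lemma emb_in_target: "x \<in> mspace m \<Longrightarrow> emb m x \<in> mspace (target_metric (base_card m))"
  by (auto simp: emb_def)

lemma coord_uniformly_continuous:
  assumes "e > 0"
  shows "\<exists>\<delta>>0. \<forall>x\<in>mspace m. \<forall>y\<in>mspace m. mdist m x y < \<delta> \<longrightarrow> \<bar>coord m c x - coord m c y\<bar> \<le> e"
proof (cases c)
  case (Inl n)
  have "\<bar>coord m c x - coord m c y\<bar> \<le> e"
    if "x \<in> mspace m" "y \<in> mspace m" "mdist m x y < min (1 / real (Suc n)) (e / 2)" for x y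
    using chain_cost_abs_close[of x m y n] that by (simp add: coord_def Inl)
  then show ?thesis using assms by (intro exI[of _ "min (1 / real (Suc n)) (e / 2)"]) auto
next
  case (Inr t)
  obtain k L i where t: "t = (k, L, i)" by (cases t)
  have "\<bar>coord m c x - coord m c y\<bar> \<le> e"
    if "x \<in> mspace m" "y \<in> mspace m" "mdist m x y < min (1 / real (Suc (length L))) e" for x y
    using net_dist_close[of x m y L k i] that by (simp add: coord_def Inr t)
  then show ?thesis using assms by (intro exI[of _ "min (1 / real (Suc (length L))) e"]) auto
qed

lemma emb_uniformly_continuous: "uniformly_continuous_map m (target_metric (base_card m)) (emb m)"
  unfolding uniformly_continuous_map_def
proof (intro conjI allI impI)
  show "emb m \<in> mspace m \<rightarrow> mspace (target_metric (base_card m))"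
    by (rule funcsetI) (rule emb_in_target)
  fix e :: real assume "e > 0"
  then have e4: "e / 4 > 0" by simp
  obtain n where n: "1 / real (Suc n) < e / 4"
    using nat_approx_posE[OF e4] by blast
  obtain N where N: "(1/2) ^ N < e / 4"
    using real_arch_pow_inv[OF e4, of "1/2"] by auto
  have "\<exists>\<delta>. \<forall>i. \<delta> i > 0 \<and> (\<forall>x\<in>mspace m. \<forall>y\<in>mspace m. mdist m x y < \<delta> i \<longrightarrow>
      \<bar>coord m (from_nat i) x - coord m (from_nat i) y\<bar> \<le> e / 4)"
    using coord_uniformly_continuous[OF e4] by (intro choice) blast
  then obtain \<delta> :: "nat \<Rightarrow> real" where \<delta>: "\<And>i. \<delta> i > 0"
    and close: "\<And>i x y. x \<in> mspace m \<Longrightarrow> y \<in> mspace m \<Longrightarrow> mdist m x y < \<delta> i \<Longrightarrow>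
      \<bar>coord m (from_nat i) x - coord m (from_nat i) y\<bar> \<le> e / 4"
    by blast
  define d where "d = Min (insert (1 / real (Suc n)) (\<delta> ` {..<N}))"
  have "d > 0" using \<delta> by (auto simp: d_def)
  have d_le: "d \<le> 1 / real (Suc n)" "\<And>i. i < N \<Longrightarrow> d \<le> \<delta> i"
    by (auto simp: d_def intro: Min_le)
  have "mdist (target_metric (base_card m)) (emb m y) (emb m x) < e"
    if x: "x \<in> mspace m" and y: "y \<in> mspace m" and xy: "mdist m y x < d" for x y
  proof -
    have "first_difference_dist (fst (emb m y)) (fst (emb m x)) \<le> 1 / real (Suc n)"
    proof (cases "fst (emb m y) = fst (emb m x)")
      case True
      then show ?thesis by (simp add: first_difference_dist_def)
    next
      case False
      show ?thesis
        unfolding first_difference_dist_le_iff[OF False]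
        using base_pt_eq_of_close[OF y x, of n] xy d_le(1) by (auto simp: emb_def)
    qed
    moreover have "real_sequence_dist (snd (emb m y)) (snd (emb m x)) \<le> e / 4 + (1/2) ^ N"
      using close[OF y x] xy d_le(2) e4
      by (intro real_sequence_dist_le) (force simp: emb_def)+
    ultimately show ?thesis
      unfolding mdist_target using n N \<open>e > 0\<close> by linarith
  qed
  then show "\<exists>\<delta>>0. \<forall>x\<in>mspace m. \<forall>y\<in>mspace m. mdist m y x < \<delta> \<longrightarrow>
      mdist (target_metric (base_card m)) (emb m y) (emb m x) < e"
    using \<open>d > 0\<close> by blast
qed

lemma inj_on_emb:
  assumes "Bourbaki_complete m"
  shows "inj_on (emb m) (mspace m)"
proof (rule inj_onI, rule ccontr)
  fix x y assume x: "x \<in> mspace m" and y: "y \<in> mspace m" and eq: "emb m x = emb m y" and "x \<noteq> y"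
  have "base_pt m j x = base_pt m j y" for j
    using eq by (auto simp: emb_def dest: fun_cong)
  then obtain k L i where "net_dist m k L i x \<noteq> net_dist m k L i y"
    using net_dist_separates[OF assms x y \<open>x \<noteq> y\<close>] by blast
  then have "coord m (Inr (k, L, i)) x \<noteq> coord m (Inr (k, L, i)) y"
    by (simp add: coord_def)
  moreover have "coord m (from_nat (to_nat c)) x = coord m (from_nat (to_nat c)) y"
    for c :: "nat + nat \<times> nat list \<times> nat"
    using fun_cong[of _ _ "to_nat c"] eq by (fastforce simp: emb_def)
  ultimately show False by simp
qed

text \<open>A point \<open>p\<close> of the closure of the image of a closed set \<open>C\<close> is approached along the filter on
  \<open>C\<close> generated by the preimages of the balls around \<open>p\<close>. Convergence to \<open>p\<close> fixes the base
  points and bounds the chain costs along this filter; its cluster point belongs to \<open>C\<close> and is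
  mapped to \<open>p\<close>.\<close>

lemma closed_map_emb:
  assumes bc: "Bourbaki_complete m"
  shows "closed_map (mtopology_of m) (mtopology_of (target_metric (base_card m))) (emb m)"
  unfolding closed_map_def
proof (intro allI impI)
  fix C assume C: "closedin (mtopology_of m) C"
  define T where "T = target_metric (base_card m)"
  interpret T: Metric_space "mspace T" "mdist T" by simp
  have CM: "C \<subseteq> mspace m"
    using closedin_subset[OF C] by simp
  have closure: "p \<in> emb m ` C"
    if p: "p \<in> mspace T" and near: "\<And>r. r > 0 \<Longrightarrow> \<exists>c\<in>C. mdist T p (emb m c) < r" for p
  proof -
    define S where "S r = {c \<in> C. mdist T p (emb m c) < r}" for r
    define \<F> where "\<F> = (INF r\<in>{0<..}. principal (S r))"
    have ev_iff: "eventually P \<F> \<longleftrightarrow> (\<exists>r>0. \<forall>x\<in>S r. P x)" for P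
      unfolding \<F>_def
    proof (subst eventually_INF_base)
      fix a b :: real assume "a \<in> {0<..}" "b \<in> {0<..}"
      then show "\<exists>r\<in>{0<..}. principal (S r) \<le> inf (principal (S a)) (principal (S b))"
        by (intro bexI[of _ "min a b"]) (auto simp: S_def)
    qed (auto simp: eventually_principal)
    have evS: "eventually (\<lambda>c. c \<in> S r) \<F>" if "r > 0" for r
      unfolding ev_iff using that by blast
    have "\<F> \<noteq> bot"
      unfolding trivial_limit_def ev_iff using near by (fastforce simp: S_def)
    moreover have "eventually (\<lambda>c. c \<in> mspace m) \<F>"
      using CM by (intro eventually_mono[OF evS[of 1]]) (auto simp: S_def)
    ultimately have F: "filter_on m \<F>"
      by (simp add: filter_on_def)
    have "\<exists>b R. eventually (\<lambda>x. base_pt m n x = b \<and> chain_cost m n x \<le> R) \<F>" for n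
    proof -
      define i where "i = to_nat (Inl n :: nat + nat \<times> nat list \<times> nat)"
      \<comment> \<open>The first bound makes the first component of the image of \<open>c\<close> agree with that of \<open>p\<close>
        up to index \<open>n\<close>, the second makes their \<open>i\<close>-th real coordinates differ by less than 1.\<close>
      define r where "r = min (1 / real (Suc (Suc n))) (1 / 2 ^ Suc i)"
      have "base_pt m n c = fst p n \<and> chain_cost m n c \<le> snd p i + 1" if "c \<in> S r" for c
      proof
        have less: "first_difference_dist (fst p) (fst (emb m c))
            + real_sequence_dist (snd p) (snd (emb m c)) < r"
          using that by (simp add: S_def T_def)
        have nonneg: "first_difference_dist (fst p) (fst (emb m c)) \<ge> 0"
            "real_sequence_dist (snd p) (snd (emb m c)) \<ge> 0"
          using Metric_space.nonneg[OF Metric_space_first_difference]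
            Metric_space.nonneg[OF Metric_space_real_sequence] by blast+
        show "base_pt m n c = fst p n"
        proof (cases "fst p = fst (emb m c)")
          case False
          have "first_difference_dist (fst p) (fst (emb m c)) \<le> 1 / real (Suc (Suc n))"
            using less nonneg unfolding r_def by linarith
          then show ?thesis
            unfolding first_difference_dist_le_iff[OF False] by (simp add: emb_def)
        qed (simp add: emb_def)
        have "\<bar>snd p i - snd (emb m c) i\<bar> < 1"
          using less nonneg by (intro abs_diff_less_if_real_sequence_dist) (auto simp: r_def)
        moreover have "snd (emb m c) i = chain_cost m n c"
          by (simp add: emb_def i_def coord_def)
        ultimately show "chain_cost m n c \<le> snd p i + 1" by linarith
      qed
      moreover have "r > 0" by (simp add: r_def)
      ultimately show ?thesis
        unfolding ev_iff by blast
    qed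
    then obtain x where x: "cluster_point m \<F> x"
      using cluster_point_if_chain_costs_bounded[OF bc F] by blast
    then have xM: "x \<in> mspace m" by (simp add: cluster_point_def)
    have meets: "V \<inter> S r \<noteq> {}" if "openin (mtopology_of m) V" "x \<in> V" "r > 0" for V r
      using x that evS[of r] unfolding cluster_point_def by blast
    have "x \<in> C"
    proof (rule ccontr)
      assume "x \<notin> C"
      moreover have "openin (mtopology_of m) (mspace m - C)"
        using C by (simp add: closedin_def)
      ultimately show False
        using meets[of "mspace m - C" 1] xM by (auto simp: S_def)
    qed
    moreover have "emb m x = p"
    proof (rule ccontr)
      assume "emb m x \<noteq> p"
      have eT: "emb m y \<in> mspace T" if "y \<in> mspace m" for y
        using emb_in_target[OF that] by (simp add: T_def)
      define r where "r = mdist T (emb m x) p / 2"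
      have "r > 0"
        using eT[OF xM] p \<open>emb m x \<noteq> p\<close> unfolding r_def by simp
      then obtain \<delta> where "\<delta> > 0"
        and \<delta>: "\<And>y. y \<in> mspace m \<Longrightarrow> mdist m y x < \<delta> \<Longrightarrow> mdist T (emb m y) (emb m x) < r"
        using emb_uniformly_continuous[of m] xM
        unfolding uniformly_continuous_map_def T_def by meson
      have "openin (mtopology_of m) (mball_of m x \<delta>)" "x \<in> mball_of m x \<delta>"
        using xM \<open>\<delta> > 0\<close> by (simp_all add: openin_mball_of)
      then obtain c where c: "c \<in> mball_of m x \<delta>" "c \<in> S r"
        using meets \<open>r > 0\<close> by blast
      then have cM: "c \<in> mspace m" by simp
      have "mdist T (emb m c) (emb m x) < r"
        using \<delta>[OF cM] c(1) by (simp add: mdist_commute)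
      moreover have "mdist T p (emb m c) < r"
        using c(2) by (simp add: S_def)
      ultimately have "mdist T p (emb m x) < 2 * r"
        using T.triangle[OF p eT[OF cM] eT[OF xM]] by linarith
      then show False by (simp add: r_def T.commute)
    qed
    ultimately show ?thesis by blast
  qed
  have sub: "emb m ` C \<subseteq> mspace T"
    unfolding T_def
  proof (rule image_subsetI)
    fix c assume "c \<in> C"
    then show "emb m c \<in> mspace (target_metric (base_card m))"
      using CM by (intro emb_in_target) blast
  qed
  have "closedin T.mtopology (emb m ` C)"
    unfolding T.closedin_metric
  proof (intro conjI sub allI impI)
    fix p assume p: "p \<in> mspace T - emb m ` C"
    then obtain r where "r > 0" and r: "\<not> (\<exists>c\<in>C. mdist T p (emb m c) < r)"
      using closure[of p] by blast
    have "disjnt (emb m ` C) (T.mball p r)"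
      unfolding disjnt_iff using r by auto
    with \<open>r > 0\<close> show "\<exists>r>0. disjnt (emb m ` C) (T.mball p r)"
      by blast
  qed
  then show "closedin (mtopology_of (target_metric (base_card m))) (emb m ` C)"
    by (simp add: mtopology_of_def T_def)
qed

section \<open>Uniform partitions\<close>

text \<open>At a scale \<open>n\<close> fine enough for \<open>P\<close>, a chain cannot leave the member of \<open>P\<close> in which it
  starts, so the base point at scale \<open>n\<close> of a point determines the member of \<open>P\<close> containing that
  point. The other factors of the product only make it larger.\<close>

lemma uniform_partition_card_le:
  assumes P: "uniform_partition m P"
  shows "\<exists>n. |P| \<le>o |\<Pi>\<^sub>E j\<in>{..n}. base_pt m j ` mspace m|"
proof -
  have part: "partition_on (mspace m) P" and unif: "P \<in> metric_uniformity m"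
    using P by (auto simp: uniform_partition_def)
  obtain n where fine: "\<And>x y. (x, y) \<in> step m n \<Longrightarrow> \<exists>U\<in>P. x \<in> U \<and> y \<in> U"
    using metric_uniformity_fine[OF unif] by metis
  have same: "y \<in> U" if "(x, y) \<in> (step m n)\<^sup>*" "U \<in> P" "x \<in> U" for x y U
    using that(1)
  proof induction
    case (step y z)
    obtain V where V: "V \<in> P" "y \<in> V" "z \<in> V"
      using fine[OF step.hyps(2)] by blast
    have "V = U"
      using partition_onD2[OF part] V(1,2) \<open>U \<in> P\<close> step.IH unfolding disjoint_def by blast
    then show ?case using V(3) by simp
  qed (rule that(3))
  define pt where "pt U = (SOME x. x \<in> U)" for U :: "'a set"
  have pt: "pt U \<in> U" "pt U \<in> mspace m" if "U \<in> P" for U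
  proof -
    have "U \<noteq> {}" "U \<subseteq> mspace m"
      using part that by (auto simp: partition_on_def)
    then show "pt U \<in> U" "pt U \<in> mspace m"
      unfolding pt_def by (metis some_in_eq subsetD)+
  qed
  have "inj_on (\<lambda>U. \<lambda>j\<in>{..n}. base_pt m j (pt U)) P"
  proof (rule inj_onI)
    fix U V assume U: "U \<in> P" and V: "V \<in> P"
      and "(\<lambda>j\<in>{..n}. base_pt m j (pt U)) = (\<lambda>j\<in>{..n}. base_pt m j (pt V))"
    then have "base_pt m n (pt U) = base_pt m n (pt V)"
      by (metis atMost_iff order_refl restrict_apply')
    then have "pt V \<in> U"
      using same[OF _ U pt(1)[OF U]] by (simp add: base_pt_eq_iff)
    then show "U = V"
      using partition_onD2[OF part] U V pt(1)[OF V] unfolding disjoint_def by blast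
  qed
  moreover have "(\<lambda>U. \<lambda>j\<in>{..n}. base_pt m j (pt U)) ` P \<subseteq> (\<Pi>\<^sub>E j\<in>{..n}. base_pt m j ` mspace m)"
    using pt(2) by (intro image_subsetI restrict_PiE_iff[THEN iffD2]) blast
  ultimately have "|P| \<le>o |\<Pi>\<^sub>E j\<in>{..n}. base_pt m j ` mspace m|"
    by (intro card_of_ordLeq[THEN iffD1] exI conjI)
  then show ?thesis ..
qed

theorem theorem2p1p13:
  fixes m :: "'a metric"
  assumes "Bourbaki_complete m"
  shows "\<exists>(\<kappa> :: nat \<Rightarrow> 'a rel) (\<phi> :: 'a \<Rightarrow> (nat \<Rightarrow> 'a) \<times> (nat \<Rightarrow> real)).
    (\<forall>n. Card_order (\<kappa> n)) \<and>
    embedding_map (mtopology_of m) (mtopology_of (target_metric \<kappa>)) \<phi> \<and>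
    uniformly_continuous_map m (target_metric \<kappa>) \<phi> \<and>
    closedin (mtopology_of (target_metric \<kappa>)) (\<phi> ` mspace m) \<and>
    uniform_partition_sup m \<le>o card_Sup {|\<Pi>\<^sub>E j\<in>{..n}. Field (\<kappa> j)| | n. True}"
proof (intro exI[of _ "base_card m"] exI[of _ "emb m"] conjI allI)
  show "Card_order (base_card m n)" for n
    by (simp add: base_card_def card_of_Card_order)
  show uc: "uniformly_continuous_map m (target_metric (base_card m)) (emb m)"
    by (rule emb_uniformly_continuous)
  have closed: "closed_map (mtopology_of m) (mtopology_of (target_metric (base_card m))) (emb m)"
    by (rule closed_map_emb[OF assms])
  show "embedding_map (mtopology_of m) (mtopology_of (target_metric (base_card m))) (emb m)"
    using closed uniformly_continuous_imp_continuous_map[OF uc] inj_on_emb[OF assms]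
    by (intro injective_closed_imp_embedding_map) auto
  show "closedin (mtopology_of (target_metric (base_card m))) (emb m ` mspace m)"
    using closed closedin_topspace[of "mtopology_of m"] unfolding closed_map_def by simp
  let ?S = "{|\<Pi>\<^sub>E j\<in>{..n}. Field (base_card m j)| | n. True}"
  have sup: "is_card_Sup ?S (card_Sup ?S)"
    by (rule is_card_Sup_card_Sup) (auto simp: card_of_Card_order)
  show "uniform_partition_sup m \<le>o card_Sup ?S"
    unfolding uniform_partition_sup_def
  proof (rule card_Sup_least)
    show "Card_order (card_Sup ?S)"
      using sup by (simp add: is_card_Sup_def)
    fix s assume "s \<in> {|P| |P. uniform_partition m P}"
    then obtain P where P: "s = |P|" "uniform_partition m P" by blast
    then show "Card_order s" by (simp add: card_of_Card_order)
    obtain n where "|P| \<le>o |\<Pi>\<^sub>E j\<in>{..n}. Field (base_card m j)|"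
      using uniform_partition_card_le[OF P(2)] by auto
    moreover have "|\<Pi>\<^sub>E j\<in>{..n}. Field (base_card m j)| \<le>o card_Sup ?S"
      using sup unfolding is_card_Sup_def by blast
    ultimately show "s \<le>o card_Sup ?S"
      unfolding P(1) by (rule ordLeq_transitive)
  qed
qed

end
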